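(* Let $\Omega$ be a Lebesgue measurable subset of $\mathbb{R}^N$ with finite Lebesgue measure, $T>0$ and $\lambda>0$. Then $D(\zeta_{\infty,\lambda\Omega})=D(\zeta_{\infty,\Omega})=\overline{\dim}_B(\infty,\Omega)$ and $$\zeta_{\infty,\lambda\Omega}(s;\lambda T)=\lambda^{-s}\zeta_{\infty,\Omega}(s;T)$$ for all $s\in\mathbb{C}$ with $\operatorname{Re}s>\overline{\dim}_B(\infty,\Omega)$. Furthermore, if $\omega$ is a simple pole of a meromorphic extension of $\zeta_{\infty,\Omega}$ to some open connected neighborhood of the critical line $\{\operatorname{Re}s=\overline{\dim}_B(\infty,\Omega)\}$, then $$\operatorname{res}(\zeta_{\infty,\lambda\Omega},\omega)=\lambda^{-\omega}\operatorname{res}(\zeta_{\infty,\Omega},\omega).$$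
   Context: $|\cdot|$ denotes the Euclidean norm of a vector in $\mathbb{R}^N$ and the $N$-dimensional Lebesgue measure of a set. $\lambda\Omega:=\{\lambda x:x\in\Omega\}$. For $t>0$, ${}_t\Omega:=B_t(0)^c\cap\Omega$, where $B_t(0)$ is the open Euclidean ball of radius $t$ centered at $0$. For $r\in\mathbb{R}$, $\overline{\mathcal M}^r(\infty,\Omega):=\limsup_{t\to+\infty}|{}_t\Omega|/t^{N+r}$, and the upper Minkowski dimension at infinity is $\overline{\dim}_B(\infty,\Omega):=\inf\{r\in\mathbb{R}:\overline{\mathcal M}^r(\infty,\Omega)=0\}$. The distance zeta function at infinity is $\zeta_{\infty,\Omega}(s;T):=\int_{{}_T\Omega}|x|^{-s-N}\,dx$ for $T>0$, written $\zeta_{\infty,\Omega}(s)$ when the choice of $T$ is irrelevant (changing $T$ only adds an entire function). Its abscissa of convergence $D(\zeta_{\infty,\Omega})$ is the infimum of all $\sigma\in\mathbb{R}$ such that the integral converges absolutely for all $s$ with $\operatorname{Re}s>\sigma$. Meromorphic extension means extension from $\{\operatorname{Re}s>\overline{\dim}_B(\infty,\Omega)\}$. $\operatorname{res}(f,\omega)$ is the residue of $f$ at $\omega$. *)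

theory Defs
  imports "HOL-Complex_Analysis.Complex_Analysis"
begin

definition dilation :: "real \<Rightarrow> (real ^ 'n) set \<Rightarrow> (real ^ 'n) set" where
  "dilation c \<Omega> = (\<lambda>x. c *\<^sub>R x) ` \<Omega>"

definition tail_part :: "real \<Rightarrow> (real ^ 'n) set \<Rightarrow> (real ^ 'n) set" where
  "tail_part t \<Omega> = - ball 0 t \<inter> \<Omega>"

text \<open>The extended measure is used so that a set of infinite measure does not get content 0.\<close>

definition upper_Minkowski_content_at_inf :: "real \<Rightarrow> (real ^ 'n) set \<Rightarrow> ennreal" where
  "upper_Minkowski_content_at_inf r \<Omega> =
     Limsup at_top (\<lambda>t::real.
       emeasure lebesgue (tail_part t \<Omega>) / ennreal (t powr (real CARD('n) + r)))"

text \<open>The dimension and the abscissa below are infima in the extended reals: both are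
  \<^term>\<open>- \<infinity> :: ereal\<close> when \<open>\<Omega>\<close> is bounded, for instance.\<close>

definition upper_Minkowski_dim_at_inf :: "(real ^ 'n) set \<Rightarrow> ereal" where
  "upper_Minkowski_dim_at_inf \<Omega> =
     Inf (ereal ` {r. upper_Minkowski_content_at_inf r \<Omega> = 0})"

definition zeta_at_inf_integrand :: "complex \<Rightarrow> real ^ 'n \<Rightarrow> complex" where
  "zeta_at_inf_integrand s x = complex_of_real (norm x) powr (- s - of_nat CARD('n))"

definition zeta_at_inf :: "(real ^ 'n) set \<Rightarrow> real \<Rightarrow> complex \<Rightarrow> complex" where
  "zeta_at_inf \<Omega> T s = (LINT x:tail_part T \<Omega>|lebesgue. zeta_at_inf_integrand s x)"

definition zeta_at_inf_abscissa :: "(real ^ 'n) set \<Rightarrow> real \<Rightarrow> ereal" where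
  "zeta_at_inf_abscissa \<Omega> T =
     Inf (ereal ` {\<sigma>. \<forall>s. Re s > \<sigma> \<longrightarrow>
       set_integrable lebesgue (tail_part T \<Omega>) (zeta_at_inf_integrand s)})"

text \<open>\<open>f\<close> is a meromorphic extension, to the open connected neighbourhood \<open>U\<close> of the critical
  line, of the zeta function restricted to the half-plane to the right of that line. Gluing \<open>f\<close>
  with the zeta function gives a function on the union of \<open>U\<close> and the half-plane, so it
  is not required that \<open>U\<close> contains the half-plane.\<close>

definition zeta_at_inf_mero_extension ::
  "(real ^ 'n) set \<Rightarrow> real \<Rightarrow> complex set \<Rightarrow> (complex \<Rightarrow> complex) \<Rightarrow> bool" where
  "zeta_at_inf_mero_extension \<Omega> T U f \<longleftrightarrow>
     open U \<and> connected U \<and>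
     {s. ereal (Re s) = upper_Minkowski_dim_at_inf \<Omega>} \<subseteq> U \<and>
     f meromorphic_on U \<and>
     (\<forall>s\<in>U. ereal (Re s) > upper_Minkowski_dim_at_inf \<Omega> \<longrightarrow> f s = zeta_at_inf \<Omega> T s)"

definition is_simple_pole :: "(complex \<Rightarrow> complex) \<Rightarrow> complex \<Rightarrow> bool" where
  "is_simple_pole f z \<longleftrightarrow> is_pole f z \<and> zorder f z = -1"

end

theory Submission
  imports Defs
begin

text \<open>
  Write \<open>N\<close> for the dimension of the space. Everything rests on three facts.

  The abscissa of convergence equals the dimension (\<open>zeta_at_inf_abscissa_eq_dim\<close>). If the tail
  from radius \<open>t\<close> on has measure at most \<open>t powr (N + r)\<close>, then a dyadic decomposition bounds the
  integral at \<open>s\<close> by a geometric series of ratio \<open>2 powr (r - Re s)\<close>, which converges for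
  \<open>r < Re s\<close> (\<open>set_integrable_if_power_decay\<close>). Conversely, convergence of the integral at a real
  point \<open>r \<le> - N\<close> bounds the tails by Chebyshev's inequality (\<open>power_bound_if_set_integrable\<close>),
  while for \<open>r > - N\<close> the content vanishes because the whole set has finite measure.

  The substitution \<open>x \<mapsto> c x\<close> maps the tail of \<open>\<Omega>\<close> with cutoff \<open>T\<close> onto the tail of the dilated set
  with cutoff \<open>c T\<close>, has Jacobian \<open>c ^ N\<close>, and multiplies the integrand by \<open>c powr (- s - N)\<close>. This
  yields the scaling relation (\<open>zeta_at_inf_dilation\<close>) and the equality of the abscissae, hence of
  the dimensions.

  Two cutoffs of the same zeta function differ by the integral over a bounded shell, which is
  entire in \<open>s\<close> (\<open>entire_cutoff_difference\<close>). So if \<open>f\<close> extends the zeta function of \<open>\<Omega>\<close>, then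
  \<open>c powr (- s) * f s + h s\<close> with an entire \<open>h\<close> extends that of the dilated set
  (\<open>dilated_mero_extension\<close>). At a simple pole the residue of this function is
  \<open>c powr (- \<omega>)\<close> times that of \<open>f\<close> (\<open>residue_times_plus_analytic\<close>), and by the identity theorem any
  other extension to the same domain has the same residue (\<open>mero_extension_unique\<close>).
\<close>

section \<open>The integrand and the tails\<close>

lemma zeta_at_inf_integrand_eq_exp:
  fixes x :: "real ^ 'n"
  assumes "x \<noteq> 0"
  shows "zeta_at_inf_integrand s x = exp ((- s - of_nat CARD('n)) * of_real (ln (norm x)))"
  using assms by (simp add: zeta_at_inf_integrand_def powr_def Ln_of_real)

lemma norm_zeta_at_inf_integrand:
  fixes x :: "real ^ 'n"
  shows "norm (zeta_at_inf_integrand s x) = norm x powr (- Re s - real CARD('n))"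
  by (cases "x = 0")
     (auto simp: zeta_at_inf_integrand_eq_exp zeta_at_inf_integrand_def[of _ 0] powr_def)

lemma borel_measurable_zeta_at_inf_integrand [measurable]:
  "(zeta_at_inf_integrand s :: real ^ 'n \<Rightarrow> complex) \<in> borel_measurable lebesgue"
proof -
  have "(\<lambda>x::real ^ 'n. if x = 0 then 0
          else exp ((- s - of_nat CARD('n)) * of_real (ln (norm x)))) \<in> borel_measurable borel"
    by measurable
  moreover have "(zeta_at_inf_integrand s :: real ^ 'n \<Rightarrow> complex) =
      (\<lambda>x. if x = 0 then 0 else exp ((- s - of_nat CARD('n)) * of_real (ln (norm x))))"
    by (auto simp: fun_eq_iff zeta_at_inf_integrand_eq_exp zeta_at_inf_integrand_def[of _ 0])
  ultimately show ?thesis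
    by (auto intro: measurable_completion)
qed

lemma sets_tail_part [measurable]:
  "\<Omega> \<in> sets lebesgue \<Longrightarrow> tail_part t \<Omega> \<in> sets lebesgue"
  unfolding tail_part_def by (intro sets.Int) (auto intro: borel_comp)

lemma emeasure_tail_part_le:
  "\<Omega> \<in> sets lebesgue \<Longrightarrow> emeasure lebesgue (tail_part t \<Omega>) \<le> emeasure lebesgue \<Omega>"
  by (intro emeasure_mono) (auto simp: tail_part_def)

lemma in_tail_part_iff: "x \<in> tail_part t \<Omega> \<longleftrightarrow> t \<le> norm x \<and> x \<in> \<Omega>"
  by (auto simp: tail_part_def)

lemma set_integrable_tail_part_iff:
  assumes "\<Omega> \<in> sets lebesgue"
  shows "set_integrable lebesgue (tail_part T \<Omega>) (zeta_at_inf_integrand s :: real ^ 'n \<Rightarrow> complex) \<longleftrightarrow>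
    (\<integral>\<^sup>+x. ennreal (norm x powr (- Re s - real CARD('n))) * indicator (tail_part T \<Omega>) x \<partial>lebesgue) < \<infinity>"
proof -
  note [measurable] = assms
  have "(\<integral>\<^sup>+x. ennreal (norm (indicator (tail_part T \<Omega>) x *\<^sub>R zeta_at_inf_integrand s x)) \<partial>lebesgue)
      = (\<integral>\<^sup>+x. ennreal (norm x powr (- Re s - real CARD('n))) * indicator (tail_part T \<Omega>) x \<partial>lebesgue)"
    by (intro nn_integral_cong)
       (auto simp: norm_zeta_at_inf_integrand indicator_def)
  moreover have "(\<lambda>x. indicator (tail_part T \<Omega>) x *\<^sub>R zeta_at_inf_integrand s x) \<in> borel_measurable lebesgue"
    by measurable
  ultimately show ?thesis
    unfolding set_integrable_def integrable_iff_bounded by simp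
qed

section \<open>Changing the cutoff radius\<close>

text \<open>Expand the exponential in its power series and integrate term by term: on a set of
  finite measure on which \<open>\<phi>\<close> is bounded, the sum of the \<open>L\<^sup>1\<close> norms of the terms is at most
  \<open>measure M A * exp (norm z * L)\<close>. The integral is therefore an everywhere convergent power
  series whose coefficients are the moments of \<open>\<phi>\<close>.\<close>

lemma entire_exponential_integral:
  fixes \<phi> :: "'a \<Rightarrow> real"
  assumes A [measurable]: "A \<in> sets M" and fin: "emeasure M A < \<infinity>"
    and \<phi> [measurable]: "\<phi> \<in> borel_measurable M" and L: "\<And>x. x \<in> A \<Longrightarrow> \<bar>\<phi> x\<bar> \<le> L"
  shows "(\<lambda>z. LINT x:A|M. exp (z * complex_of_real (\<phi> x))) holomorphic_on UNIV"
proof -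
  define a where "a = (\<lambda>n. LINT x:A|M. complex_of_real (\<phi> x) ^ n / fact n)"
  define F where "F = (\<lambda>z. LINT x:A|M. exp (z * complex_of_real (\<phi> x)))"
  have sums: "(\<lambda>n. a n * z ^ n) sums F z" for z
  proof -
    define f where "f = (\<lambda>n x. indicator A x *\<^sub>R ((z * complex_of_real (\<phi> x)) ^ n /\<^sub>R fact n))"
    have bound: "norm (f n x) \<le> indicator A x * ((norm z * L) ^ n / fact n)" for n x
      using L[of x]
      by (auto simp: f_def indicator_def norm_mult norm_power divide_simps
               intro!: power_mono mult_left_mono)
    have int: "integrable M (f n)" for n
      unfolding f_def
    proof (rule integrableI_bounded_set_indicator[where B = "(norm z * L) ^ n / fact n"])
      show "AE x in M. x \<in> A \<longrightarrow> norm ((z * complex_of_real (\<phi> x)) ^ n /\<^sub>R fact n) \<le> (norm z * L) ^ n / fact n"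
      proof (intro AE_I2 impI)
        fix x assume "x \<in> A"
        then show "norm ((z * complex_of_real (\<phi> x)) ^ n /\<^sub>R fact n) \<le> (norm z * L) ^ n / fact n"
          using bound[of n x] by (simp add: f_def)
      qed
    qed (use fin in auto)
    have sm: "summable (\<lambda>n. norm (f n x))" for x
      by (rule summable_comparison_test'[OF summable_norm_exp[of "z * complex_of_real (\<phi> x)"], of 0])
         (auto simp: f_def indicator_def)
    have "summable (\<lambda>n. \<integral>x. norm (f n x) \<partial>M)"
    proof (rule summable_comparison_test')
      show "summable (\<lambda>n. measure M A * ((norm z * L) ^ n /\<^sub>R fact n))"
        by (intro summable_mult summable_exp_generic)
      fix n :: nat
      have "(\<integral>x. norm (f n x) \<partial>M) \<le> (\<integral>x. indicator A x * ((norm z * L) ^ n / fact n) \<partial>M)"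
        using fin by (intro integral_mono integrable_norm int bound integrable_mult_left
             integrable_real_indicator A)
      also have "\<dots> = measure M A * ((norm z * L) ^ n /\<^sub>R fact n)"
        using sets.sets_into_space[OF A] by (simp add: field_simps Int_absorb2)
      finally show "norm (\<integral>x. norm (f n x) \<partial>M) \<le> measure M A * ((norm z * L) ^ n /\<^sub>R fact n)"
        by simp
    qed
    then have "(\<lambda>n. integral\<^sup>L M (f n)) sums (\<integral>x. (\<Sum>n. f n x) \<partial>M)"
      using int sm by (intro sums_integral) auto
    also have "(\<lambda>n. integral\<^sup>L M (f n)) = (\<lambda>n. a n * z ^ n)"
    proof
      fix n
      have "f n = (\<lambda>x. (indicator A x *\<^sub>R (complex_of_real (\<phi> x) ^ n / fact n)) * z ^ n)"
        by (auto simp: f_def fun_eq_iff indicator_def power_mult_distrib scaleR_conv_of_real divide_simps)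
      then show "integral\<^sup>L M (f n) = a n * z ^ n"
        by (simp only: a_def set_lebesgue_integral_def integral_mult_left_zero)
    qed
    also have "(\<lambda>x. \<Sum>n. f n x) = (\<lambda>x. indicator A x *\<^sub>R exp (z * complex_of_real (\<phi> x)))"
      by (auto simp: f_def fun_eq_iff indicator_def exp_def)
    finally show ?thesis
      by (simp add: F_def set_lebesgue_integral_def)
  qed
  have "F holomorphic_on ball 0 r" for r
    by (rule power_series_holomorphic[where a = a]) (use sums in auto)
  then have "F field_differentiable at z" for z
    using holomorphic_on_imp_differentiable_at[of F "ball 0 (norm z + 1)" z] by auto
  then show ?thesis
    unfolding F_def by (simp add: holomorphic_on_def)
qed

text \<open>A difference of two tails is a spherical shell. There the integrand is the exponential of
  a multiple of the bounded function \<open>ln (norm x)\<close>, so that shells contribute a convergent and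
  entire part to the zeta function.\<close>

lemma shell_bounded_log:
  assumes "0 < T1" "x \<in> tail_part T1 \<Omega> - tail_part T2 \<Omega>"
  shows "\<bar>ln (norm x)\<bar> \<le> max \<bar>ln T1\<bar> \<bar>ln T2\<bar>"
proof -
  have "T1 \<le> norm x" "norm x < T2"
    using assms by (auto simp: in_tail_part_iff)
  then have "ln T1 \<le> ln (norm x)" "ln (norm x) \<le> ln T2"
    using assms by (auto intro!: ln_mono)
  then show ?thesis by linarith
qed

context
  fixes \<Omega> :: "(real ^ 'n) set"
  assumes \<Omega> [measurable]: "\<Omega> \<in> sets lebesgue" and fin: "emeasure lebesgue \<Omega> < \<infinity>"
begin

lemma emeasure_tail_part_finite: "emeasure lebesgue (tail_part t \<Omega>) < \<infinity>"
  using emeasure_tail_part_le[OF \<Omega>, of t] fin by (rule le_less_trans)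

lemma emeasure_shell_finite: "emeasure lebesgue (tail_part t \<Omega> - tail_part u \<Omega>) < \<infinity>"
  by (rule le_less_trans[OF emeasure_mono emeasure_tail_part_finite[of t]]) auto

lemma set_integrable_shell:
  assumes "0 < T1"
  shows "set_integrable lebesgue (tail_part T1 \<Omega> - tail_part T2 \<Omega>) (zeta_at_inf_integrand s)"
  unfolding set_integrable_def
proof (rule integrableI_bounded_set_indicator)
  let ?B = "exp (\<bar>- Re s - real CARD('n)\<bar> * max \<bar>ln T1\<bar> \<bar>ln T2\<bar>)"
  have "norm (zeta_at_inf_integrand s x) \<le> ?B" if "x \<in> tail_part T1 \<Omega> - tail_part T2 \<Omega>" for x
  proof -
    have "(- Re s - real CARD('n)) * ln (norm x) \<le> \<bar>- Re s - real CARD('n)\<bar> * \<bar>ln (norm x)\<bar>"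
      by (metis abs_ge_self abs_mult)
    also have "\<dots> \<le> \<bar>- Re s - real CARD('n)\<bar> * max \<bar>ln T1\<bar> \<bar>ln T2\<bar>"
      using shell_bounded_log[OF assms that] by (intro mult_left_mono) auto
    finally show ?thesis
      by (auto simp: norm_zeta_at_inf_integrand powr_def)
  qed
  then show "AE x in lebesgue. x \<in> tail_part T1 \<Omega> - tail_part T2 \<Omega> \<longrightarrow> norm (zeta_at_inf_integrand s x) \<le> ?B"
    by auto
qed (use emeasure_shell_finite in auto)

lemma entire_shell_integral:
  assumes "0 < T1"
  shows "(\<lambda>s. LINT x:tail_part T1 \<Omega> - tail_part T2 \<Omega>|lebesgue. zeta_at_inf_integrand s x) holomorphic_on UNIV"
proof -
  let ?A = "tail_part T1 \<Omega> - tail_part T2 \<Omega>"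
  let ?F = "\<lambda>z. LINT x:?A|lebesgue. exp (z * complex_of_real (ln (norm x)))"
  have "?F holomorphic_on UNIV"
  proof (rule entire_exponential_integral[OF _ emeasure_shell_finite _ shell_bounded_log[OF assms]])
    show "(\<lambda>x::real ^ 'n. ln (norm x)) \<in> borel_measurable lebesgue"
      by (intro measurable_completion) measurable
  qed auto
  then have "(?F \<circ> (\<lambda>s. - s - of_nat CARD('n))) holomorphic_on UNIV"
    by (intro holomorphic_on_compose_gen[where t = UNIV] holomorphic_intros) auto
  also have "?F \<circ> (\<lambda>s. - s - of_nat CARD('n)) = (\<lambda>s. LINT x:?A|lebesgue. zeta_at_inf_integrand s x)"
  proof
    fix s
    have "x \<noteq> 0" if "x \<in> ?A" for x
      using that assms by (auto simp: in_tail_part_iff)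
    then show "(?F \<circ> (\<lambda>s. - s - of_nat CARD('n))) s = (LINT x:?A|lebesgue. zeta_at_inf_integrand s x)"
      unfolding comp_def
      by (intro set_lebesgue_integral_cong allI impI zeta_at_inf_integrand_eq_exp[symmetric])
         (auto intro: sets_tail_part[OF \<Omega>])
  qed
  finally show ?thesis .
qed

lemma set_integrable_tail_part_antimono:
  assumes "set_integrable lebesgue (tail_part T1 \<Omega>) (zeta_at_inf_integrand s)" "T1 \<le> T2"
  shows "set_integrable lebesgue (tail_part T2 \<Omega>) (zeta_at_inf_integrand s)"
  using assms(1) by (rule set_integrable_subset) (use assms(2) in \<open>auto simp: in_tail_part_iff\<close>)

lemma set_integrable_tail_part_cutoff:
  assumes "set_integrable lebesgue (tail_part T1 \<Omega>) (zeta_at_inf_integrand s)" "0 < T2"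
  shows "set_integrable lebesgue (tail_part T2 \<Omega>) (zeta_at_inf_integrand s)"
proof -
  have "set_integrable lebesgue (tail_part T1 \<Omega> \<union> (tail_part T2 \<Omega> - tail_part T1 \<Omega>)) (zeta_at_inf_integrand s)"
    using assms by (intro set_integrable_Un set_integrable_shell) auto
  then show ?thesis
    by (rule set_integrable_subset) auto
qed

lemma zeta_at_inf_eq_shell:
  assumes "set_integrable lebesgue (tail_part T1 \<Omega>) (zeta_at_inf_integrand s)" "0 < T1" "T1 \<le> T2"
  shows "zeta_at_inf \<Omega> T1 s = zeta_at_inf \<Omega> T2 s +
           (LINT x:tail_part T1 \<Omega> - tail_part T2 \<Omega>|lebesgue. zeta_at_inf_integrand s x)"
proof -
  have "tail_part T1 \<Omega> = tail_part T2 \<Omega> \<union> (tail_part T1 \<Omega> - tail_part T2 \<Omega>)"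
    using assms(3) by (auto simp: in_tail_part_iff)
  then show ?thesis
    unfolding zeta_at_inf_def
    using set_integral_Un[OF _ set_integrable_tail_part_antimono[OF assms(1,3)]
        set_integrable_shell[OF assms(2)], of T2]
    by simp
qed

end

section \<open>Abscissa of convergence and Minkowski dimension\<close>

text \<open>A dyadic decomposition: for \<open>2 ^ k * T \<le> norm x < 2 ^ (k + 1) * T\<close> the integrand is
  comparable with its value at radius \<open>2 ^ k * T\<close>, and by the decay hypothesis the whole tail
  from that radius on contributes a multiple of \<open>(2 powr (r - Re s)) ^ k\<close>. This is summable since
  \<open>r < Re s\<close>.\<close>

lemma set_integrable_if_power_decay:
  fixes \<Omega> :: "(real ^ 'n) set"
  assumes \<Omega> [measurable]: "\<Omega> \<in> sets lebesgue" and T: "0 < T" and r: "r < Re s"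
    and decay: "\<And>t. T \<le> t \<Longrightarrow> emeasure lebesgue (tail_part t \<Omega>) \<le> ennreal (t powr (real CARD('n) + r))"
  shows "set_integrable lebesgue (tail_part T \<Omega>) (zeta_at_inf_integrand s)"
proof -
  let ?N = "real CARD('n)"
  define a where "a = - Re s - ?N"
  \<comment> \<open>The exponent \<open>a\<close> can have either sign, so the maximum of \<open>u powr a\<close> over \<open>1 \<le> u \<le> 2\<close> may
    be attained at either end.\<close>
  define B where "B = max 1 (2 powr a)"
  define R where "R = (\<lambda>k::nat. 2 ^ k * T)"
  have R: "0 < R k" "T \<le> R k" for k
    using T by (auto simp: R_def)
  have pointwise: "ennreal (norm x powr a) * indicator (tail_part T \<Omega>) x
      \<le> (\<Sum>k. ennreal (B * R k powr a) * indicator (tail_part (R k) \<Omega>) x)" for x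
  proof (cases "x \<in> tail_part T \<Omega>")
    case True
    then have y: "1 \<le> norm x / T"
      using T by (auto simp: in_tail_part_iff)
    define k where "k = nat \<lfloor>log 2 (norm x / T)\<rfloor>"
    have "real k = of_int \<lfloor>log 2 (norm x / T)\<rfloor>"
      using y by (simp add: k_def)
    then have "2 powr real k \<le> norm x / T" "norm x / T < 2 powr (real k + 1)"
      using y floor_log_eq_powr_iff[of "norm x / T" 2 "\<lfloor>log 2 (norm x / T)\<rfloor>"] by auto
    then have k: "R k \<le> norm x" "norm x \<le> 2 * R k"
      using T by (auto simp: R_def powr_add powr_realpow field_simps)
    have "norm x powr a \<le> B * R k powr a"
    proof (cases "a \<ge> 0")
      case True
      have "norm x powr a \<le> (2 * R k) powr a"
        using k R True by (intro powr_mono2) auto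
      also have "\<dots> = 2 powr a * R k powr a"
        using R[of k] by (simp add: powr_mult)
      finally show ?thesis
        by (rule order_trans) (auto simp: B_def intro!: mult_right_mono)
    next
      case False
      have "norm x powr a \<le> 1 * R k powr a"
        using k R[of k] False by (auto intro: powr_mono2')
      also have "\<dots> \<le> B * R k powr a"
        by (intro mult_right_mono) (auto simp: B_def)
      finally show ?thesis .
    qed
    moreover have "x \<in> tail_part (R k) \<Omega>"
      using True k by (auto simp: in_tail_part_iff)
    ultimately have "ennreal (norm x powr a) * indicator (tail_part T \<Omega>) x
        \<le> (\<Sum>i\<in>{k}. ennreal (B * R i powr a) * indicator (tail_part (R i) \<Omega>) x)"
      using True by (auto intro!: ennreal_leI)
    also have "\<dots> \<le> (\<Sum>k. ennreal (B * R k powr a) * indicator (tail_part (R k) \<Omega>) x)"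
      by (intro sum_le_suminf) auto
    finally show ?thesis .
  qed auto
  have "(\<integral>\<^sup>+x. ennreal (norm x powr a) * indicator (tail_part T \<Omega>) x \<partial>lebesgue)
     \<le> (\<integral>\<^sup>+x. (\<Sum>k. ennreal (B * R k powr a) * indicator (tail_part (R k) \<Omega>) x) \<partial>lebesgue)"
    by (intro nn_integral_mono pointwise)
  also have "\<dots> = (\<Sum>k. \<integral>\<^sup>+x. ennreal (B * R k powr a) * indicator (tail_part (R k) \<Omega>) x \<partial>lebesgue)"
    by (intro nn_integral_suminf) measurable
  also have "\<dots> = (\<Sum>k. ennreal (B * R k powr a) * emeasure lebesgue (tail_part (R k) \<Omega>))"
    by (intro suminf_cong nn_integral_cmult_indicator) measurable
  also have "\<dots> \<le> (\<Sum>k. ennreal (B * T powr (r - Re s) * (2 powr (r - Re s)) ^ k))"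
  proof (intro suminf_le)
    fix k
    have "ennreal (B * R k powr a) * emeasure lebesgue (tail_part (R k) \<Omega>)
       \<le> ennreal (B * R k powr a) * ennreal (R k powr (?N + r))"
      by (intro mult_left_mono decay R) auto
    also have "\<dots> = ennreal (B * R k powr (r - Re s))"
      using R[of k] by (simp add: ennreal_mult'[symmetric] B_def mult.assoc powr_add[symmetric] a_def)
    also have "B * R k powr (r - Re s) = B * T powr (r - Re s) * (2 powr (r - Re s)) ^ k"
      using T by (simp add: R_def powr_mult powr_realpow[symmetric] powr_powr mult_ac)
    finally show "ennreal (B * R k powr a) * emeasure lebesgue (tail_part (R k) \<Omega>)
       \<le> ennreal (B * T powr (r - Re s) * (2 powr (r - Re s)) ^ k)" .
  qed auto
  also have "\<dots> < \<infinity>"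
  proof -
    have "2 powr (r - Re s) < 1"
      using r by (simp add: powr_less_one)
    then have "summable (\<lambda>k. B * T powr (r - Re s) * (2 powr (r - Re s)) ^ k)"
      by (intro summable_mult summable_geometric) auto
    then have "(\<Sum>k. ennreal (B * T powr (r - Re s) * (2 powr (r - Re s)) ^ k)) \<noteq> top"
      by (intro ennreal_suminf_neq_top) (auto simp: B_def)
    then show ?thesis
      by (simp add: less_top)
  qed
  finally show ?thesis
    unfolding set_integrable_tail_part_iff[OF \<Omega>] a_def .
qed

lemma power_decay_if_content_zero:
  fixes \<Omega> :: "(real ^ 'n) set"
  assumes "upper_Minkowski_content_at_inf r \<Omega> = 0"
  obtains T where "0 < T"
    "\<And>t. T \<le> t \<Longrightarrow> emeasure lebesgue (tail_part t \<Omega>) \<le> ennreal (t powr (real CARD('n) + r))"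
proof -
  let ?N = "real CARD('n)"
  have "eventually (\<lambda>t. emeasure lebesgue (tail_part t \<Omega>) / ennreal (t powr (?N + r)) < 1) at_top"
    using assms by (intro Limsup_lessD) (simp add: upper_Minkowski_content_at_inf_def)
  then obtain T where T: "\<And>t. T \<le> t \<Longrightarrow>
      emeasure lebesgue (tail_part t \<Omega>) / ennreal (t powr (?N + r)) < 1"
    by (auto simp: eventually_at_top_linorder)
  show ?thesis
  proof (rule that[of "max 1 T"])
    fix t assume t: "max 1 T \<le> t"
    show "emeasure lebesgue (tail_part t \<Omega>) \<le> ennreal (t powr (?N + r))"
      using T[of t] t by (simp add: divide_less_ennreal less_imp_le)
  qed auto
qed

text \<open>The normalised tail measure is at most \<open>C * t powr (r - r')\<close>, which tends to \<open>0\<close>.\<close>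

lemma content_zero_if_power_bound:
  fixes \<Omega> :: "(real ^ 'n) set"
  assumes "r < r'" "C < \<infinity>"
    and bound: "\<And>t. T \<le> t \<Longrightarrow> emeasure lebesgue (tail_part t \<Omega>) \<le> C * ennreal (t powr (real CARD('n) + r))"
  shows "upper_Minkowski_content_at_inf r' \<Omega> = 0"
proof -
  let ?N = "real CARD('n)"
  have "((\<lambda>t. emeasure lebesgue (tail_part t \<Omega>) / ennreal (t powr (?N + r'))) \<longlongrightarrow> 0) at_top"
  proof (rule tendsto_sandwich)
    show "eventually (\<lambda>t. 0 \<le> emeasure lebesgue (tail_part t \<Omega>) / ennreal (t powr (?N + r'))) at_top"
      by simp
    show "eventually (\<lambda>t. emeasure lebesgue (tail_part t \<Omega>) / ennreal (t powr (?N + r'))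
        \<le> C * ennreal (t powr (r - r'))) at_top"
      using eventually_ge_at_top[of "max 1 T"]
    proof eventually_elim
      case (elim t)
      have "emeasure lebesgue (tail_part t \<Omega>) / ennreal (t powr (?N + r'))
          \<le> C * ennreal (t powr (?N + r)) / ennreal (t powr (?N + r'))"
        using bound[of t] elim by (intro divide_right_mono_ennreal) auto
      also have "\<dots> = C * ennreal (t powr (r - r'))"
        using elim by (simp add: ennreal_times_divide[symmetric] divide_ennreal powr_diff[symmetric])
      finally show ?case .
    qed
    have "((\<lambda>t. ennreal (t powr (r - r'))) \<longlongrightarrow> ennreal 0) at_top"
      using assms(1) by (intro tendsto_ennrealI tendsto_neg_powr filterlim_ident) auto
    then have "((\<lambda>t. C * ennreal (t powr (r - r'))) \<longlongrightarrow> C * ennreal 0) at_top"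
      using assms(2) by (intro ennreal_tendsto_cmult) auto
    then show "((\<lambda>t. C * ennreal (t powr (r - r'))) \<longlongrightarrow> 0) at_top"
      by simp
  qed auto
  then show ?thesis
    unfolding upper_Minkowski_content_at_inf_def by (intro lim_imp_Limsup) auto
qed

text \<open>A Chebyshev estimate. The bound \<open>r \<le> - N\<close>, with \<open>N\<close> the dimension of the space, makes the
  exponent \<open>- r - N\<close> of the integrand nonnegative, so that the integrand is at least
  \<open>t powr (- r - N)\<close> on the tail from radius \<open>t\<close> on. Larger \<open>r\<close> are handled by the finiteness of
  the measure in the lemma \<open>content_zero_above_minus_dimension\<close> below.\<close>

lemma power_bound_if_set_integrable:
  fixes \<Omega> :: "(real ^ 'n) set"
  assumes \<Omega> [measurable]: "\<Omega> \<in> sets lebesgue" and T: "0 < T" and r: "r \<le> - real CARD('n)"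
    and int: "set_integrable lebesgue (tail_part T \<Omega>) (zeta_at_inf_integrand (of_real r))"
  obtains C where "C < \<infinity>"
    "\<And>t. T \<le> t \<Longrightarrow> emeasure lebesgue (tail_part t \<Omega>) \<le> C * ennreal (t powr (real CARD('n) + r))"
proof -
  let ?N = "real CARD('n)"
  define C where "C = (\<integral>\<^sup>+x. ennreal (norm x powr (- r - ?N)) * indicator (tail_part T \<Omega>) x \<partial>lebesgue)"
  show ?thesis
  proof (rule that[of C])
    show "C < \<infinity>"
      using int by (simp add: C_def set_integrable_tail_part_iff[OF \<Omega>])
    fix t assume t: "T \<le> t"
    have "ennreal (t powr (- r - ?N)) * emeasure lebesgue (tail_part t \<Omega>)
       = (\<integral>\<^sup>+x. ennreal (t powr (- r - ?N)) * indicator (tail_part t \<Omega>) x \<partial>lebesgue)"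
      by (intro nn_integral_cmult_indicator[symmetric]) measurable
    also have "\<dots> \<le> C"
      unfolding C_def using t T r
      by (intro nn_integral_mono)
         (auto simp: indicator_def in_tail_part_iff intro!: ennreal_leI powr_mono2)
    finally have "ennreal (t powr (- r - ?N)) * emeasure lebesgue (tail_part t \<Omega>) * ennreal (t powr (?N + r))
       \<le> C * ennreal (t powr (?N + r))"
      by (rule mult_right_mono) auto
    moreover have "ennreal (t powr (- r - ?N)) * emeasure lebesgue (tail_part t \<Omega>) * ennreal (t powr (?N + r))
      = emeasure lebesgue (tail_part t \<Omega>) * ennreal (t powr (- r - ?N) * t powr (?N + r))"
      by (simp add: ennreal_mult' mult_ac)
    moreover have "t powr (- r - ?N) * t powr (?N + r) = 1"
      using t T by (simp add: powr_add[symmetric])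
    ultimately show "emeasure lebesgue (tail_part t \<Omega>) \<le> C * ennreal (t powr (?N + r))"
      by simp
  qed
qed

text \<open>The tails are bounded by the measure of the whole set, which is a power bound with exponent
  \<open>0 = N + (- N)\<close>. In particular the dimension at infinity is at most \<open>- N\<close>.\<close>

lemma content_zero_above_minus_dimension:
  fixes \<Omega> :: "(real ^ 'n) set"
  assumes "\<Omega> \<in> sets lebesgue" "emeasure lebesgue \<Omega> < \<infinity>" "- real CARD('n) < r"
  shows "upper_Minkowski_content_at_inf r \<Omega> = 0"
  by (rule content_zero_if_power_bound[OF assms(3,2), of 1])
     (use emeasure_tail_part_le[OF assms(1)] in auto)

context
  fixes \<Omega> :: "(real ^ 'n) set"
  assumes \<Omega>: "\<Omega> \<in> sets lebesgue" and fin: "emeasure lebesgue \<Omega> < \<infinity>"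
begin

lemma set_integrable_if_content_zero:
  assumes "upper_Minkowski_content_at_inf r \<Omega> = 0" "r < Re s" "0 < T"
  shows "set_integrable lebesgue (tail_part T \<Omega>) (zeta_at_inf_integrand s)"
proof -
  obtain T0 where "0 < T0"
    "\<And>t. T0 \<le> t \<Longrightarrow> emeasure lebesgue (tail_part t \<Omega>) \<le> ennreal (t powr (real CARD('n) + r))"
    using power_decay_if_content_zero[OF assms(1)] by blast
  then show ?thesis
    using set_integrable_if_power_decay[OF \<Omega> _ assms(2)] assms(3)
    by (blast intro: set_integrable_tail_part_cutoff[OF \<Omega> fin])
qed

lemma set_integrable_above_dim:
  assumes "upper_Minkowski_dim_at_inf \<Omega> < ereal (Re s)" "0 < T"
  shows "set_integrable lebesgue (tail_part T \<Omega>) (zeta_at_inf_integrand s)"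
  using assms set_integrable_if_content_zero
  by (auto simp: upper_Minkowski_dim_at_inf_def Inf_less_iff)

lemma content_zero_if_integrable:
  assumes "\<And>s. \<sigma> < Re s \<Longrightarrow> set_integrable lebesgue (tail_part T \<Omega>) (zeta_at_inf_integrand s)"
    and "\<sigma> < r" "0 < T"
  shows "upper_Minkowski_content_at_inf r \<Omega> = 0"
proof (cases "- real CARD('n) < r")
  case True
  then show ?thesis
    by (rule content_zero_above_minus_dimension[OF \<Omega> fin])
next
  case False
  obtain r' where r': "\<sigma> < r'" "r' < r"
    using dense[OF assms(2)] by blast
  then obtain C where "C < \<infinity>"
    "\<And>t. T \<le> t \<Longrightarrow> emeasure lebesgue (tail_part t \<Omega>) \<le> C * ennreal (t powr (real CARD('n) + r'))"
    using power_bound_if_set_integrable[OF \<Omega> assms(3), of r'] False assms(1)[of "of_real r'"]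
    by auto
  then show ?thesis
    by (rule content_zero_if_power_bound[OF r'(2)])
qed

text \<open>Vanishing content at \<open>r\<close> gives convergence for every \<open>s\<close> to the right of \<open>r\<close>, and
  convergence to the right of \<open>\<sigma>\<close> gives vanishing content at every \<open>r > \<sigma>\<close>. The two sets of
  exponents therefore have the same infimum, also when it is \<open>- \<infinity>\<close>.\<close>

lemma zeta_at_inf_abscissa_eq_dim:
  assumes "0 < T"
  shows "zeta_at_inf_abscissa \<Omega> T = upper_Minkowski_dim_at_inf \<Omega>"
proof (rule antisym)
  show "zeta_at_inf_abscissa \<Omega> T \<le> upper_Minkowski_dim_at_inf \<Omega>"
    unfolding zeta_at_inf_abscissa_def upper_Minkowski_dim_at_inf_def
    using assms set_integrable_if_content_zero by (intro Inf_superset_mono) auto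
  show "upper_Minkowski_dim_at_inf \<Omega> \<le> zeta_at_inf_abscissa \<Omega> T"
    unfolding zeta_at_inf_abscissa_def
  proof (rule Inf_greatest, safe)
    fix \<sigma> :: real
    assume \<sigma>: "\<forall>s. \<sigma> < Re s \<longrightarrow> set_integrable lebesgue (tail_part T \<Omega>) (zeta_at_inf_integrand s)"
    show "upper_Minkowski_dim_at_inf \<Omega> \<le> ereal \<sigma>"
    proof (rule ereal_le_epsilon2)
      fix e :: real assume "0 < e"
      then have "upper_Minkowski_content_at_inf (\<sigma> + e) \<Omega> = 0"
        using content_zero_if_integrable[of \<sigma> T "\<sigma> + e"] \<sigma> assms by auto
      then show "upper_Minkowski_dim_at_inf \<Omega> \<le> ereal \<sigma> + ereal e"
        unfolding upper_Minkowski_dim_at_inf_def by (intro Inf_lower) auto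
    qed
  qed
qed

lemma entire_cutoff_difference:
  assumes "0 < T1" "0 < T2"
  obtains h where "h holomorphic_on UNIV"
    "\<And>s. upper_Minkowski_dim_at_inf \<Omega> < ereal (Re s) \<Longrightarrow> zeta_at_inf \<Omega> T1 s = zeta_at_inf \<Omega> T2 s + h s"
proof (cases "T1 \<le> T2")
  case True
  show ?thesis
    by (rule that[OF entire_shell_integral[OF \<Omega> fin assms(1), of T2]])
       (intro zeta_at_inf_eq_shell[OF \<Omega> fin] set_integrable_above_dim assms True)
next
  case False
  let ?h = "\<lambda>s. - (LINT x:tail_part T2 \<Omega> - tail_part T1 \<Omega>|lebesgue. zeta_at_inf_integrand s x)"
  show ?thesis
  proof (rule that[of ?h])
    show "?h holomorphic_on UNIV"
      by (intro holomorphic_on_minus entire_shell_integral[OF \<Omega> fin assms(2)])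
    fix s assume "upper_Minkowski_dim_at_inf \<Omega> < ereal (Re s)"
    then show "zeta_at_inf \<Omega> T1 s = zeta_at_inf \<Omega> T2 s + ?h s"
      using zeta_at_inf_eq_shell[OF \<Omega> fin set_integrable_above_dim, of s T2 T1] assms False by simp
  qed
qed

end

section \<open>Scaling\<close>

lemma lebesgue_scaleR:
  assumes "0 < c"
  shows "(lebesgue :: (real ^ 'n) measure) =
    density (distr lebesgue lebesgue ((*\<^sub>R) c)) (\<lambda>_. ennreal (c ^ CARD('n)))"
proof -
  have "(\<lambda>x :: real ^ 'n. 0 + (\<Sum>j\<in>Basis. (c * (x \<bullet> j)) *\<^sub>R j)) = (*\<^sub>R) c"
    unfolding scaleR_scaleR[symmetric] scaleR_sum_right[symmetric] euclidean_representation
    by auto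
  then show ?thesis
    using lebesgue_affine_euclidean[of "\<lambda>_. c" "0 :: real ^ 'n"] assms by simp
qed

lemma
  fixes F :: "real ^ 'n \<Rightarrow> 'b :: {banach, second_countable_topology}"
  assumes "0 < c" and [measurable]: "F \<in> borel_measurable lebesgue"
  shows lebesgue_integral_scaleR:
      "(LINT x|lebesgue. F x) = c ^ CARD('n) *\<^sub>R (LINT x|lebesgue. F (c *\<^sub>R x))"
    and lebesgue_integrable_scaleR_iff:
      "integrable lebesgue F \<longleftrightarrow> integrable lebesgue (\<lambda>x. F (c *\<^sub>R x))"
proof -
  have "(LINT x|lebesgue. F x) =
      (LINT x|density (distr lebesgue lebesgue ((*\<^sub>R) c)) (\<lambda>_. ennreal (c ^ CARD('n))). F x)"
    using lebesgue_scaleR[OF assms(1), where 'n = 'n] by simp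
  also have "\<dots> = (LINT x|lebesgue. c ^ CARD('n) *\<^sub>R F (c *\<^sub>R x))"
    using assms(1) by (subst integral_density) (auto simp: integral_distr)
  finally show "(LINT x|lebesgue. F x) = c ^ CARD('n) *\<^sub>R (LINT x|lebesgue. F (c *\<^sub>R x))"
    by simp
  have "integrable lebesgue F \<longleftrightarrow>
      integrable (density (distr lebesgue lebesgue ((*\<^sub>R) c)) (\<lambda>_. ennreal (c ^ CARD('n)))) F"
    using lebesgue_scaleR[OF assms(1), where 'n = 'n] by simp
  also have "\<dots> \<longleftrightarrow> integrable lebesgue (\<lambda>x. c ^ CARD('n) *\<^sub>R F (c *\<^sub>R x))"
    using assms(1) by (subst integrable_density) (auto simp: integrable_distr_eq)
  finally show "integrable lebesgue F \<longleftrightarrow> integrable lebesgue (\<lambda>x. F (c *\<^sub>R x))"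
    using assms(1) integrable_scaleR_right[of "c ^ CARD('n)" lebesgue "\<lambda>x. F (c *\<^sub>R x)"]
      integrable_scaleR_right[of "inverse (c ^ CARD('n))" lebesgue "\<lambda>x. c ^ CARD('n) *\<^sub>R F (c *\<^sub>R x)"]
    by auto
qed

lemma emeasure_dilation:
  fixes \<Omega> :: "(real ^ 'n) set"
  assumes "0 < c"
  shows "emeasure lebesgue (dilation c \<Omega>) = ennreal (c ^ CARD('n)) * emeasure lebesgue \<Omega>"
  using emeasure_lebesgue_affine[of c 0 \<Omega>] assms by (simp add: dilation_def)

lemma emeasure_dilation_finite:
  fixes \<Omega> :: "(real ^ 'n) set"
  assumes "0 < c" "emeasure lebesgue \<Omega> < \<infinity>"
  shows "emeasure lebesgue (dilation c \<Omega>) < \<infinity>"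
  using assms by (simp add: emeasure_dilation ennreal_mult_less_top)

lemma sets_dilation:
  fixes \<Omega> :: "(real ^ 'n) set"
  assumes "0 < c" "\<Omega> \<in> sets lebesgue"
  shows "dilation c \<Omega> \<in> sets lebesgue"
proof -
  have "dilation c \<Omega> = (*\<^sub>R) (1 / c) -` \<Omega> \<inter> space lebesgue"
    using assms(1) by (auto simp: dilation_def image_iff intro!: bexI[of _ "(1 / c) *\<^sub>R _"])
  then show ?thesis
    using assms(2) measurable_sets[OF lebesgue_measurable_scaling] by metis
qed

lemma scaleR_in_tail_part_dilation_iff:
  assumes "0 < c"
  shows "c *\<^sub>R x \<in> tail_part (c * T) (dilation c \<Omega>) \<longleftrightarrow> x \<in> tail_part T \<Omega>"
  using assms by (auto simp: in_tail_part_iff dilation_def)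

lemma zeta_at_inf_integrand_scaleR:
  fixes x :: "real ^ 'n"
  assumes "0 < c"
  shows "zeta_at_inf_integrand s (c *\<^sub>R x)
    = of_real c powr (- s - of_nat CARD('n)) * zeta_at_inf_integrand s x"
  using assms by (simp add: zeta_at_inf_integrand_def powr_times_real)

context
  fixes \<Omega> :: "(real ^ 'n) set" and c :: real
  assumes \<Omega>: "\<Omega> \<in> sets lebesgue" and c: "0 < c"
begin

lemma dilated_integrand_scaleR:
  "indicator (tail_part (c * T) (dilation c \<Omega>)) (c *\<^sub>R x) *\<^sub>R zeta_at_inf_integrand s (c *\<^sub>R x) =
     of_real c powr (- s - of_nat CARD('n)) * (indicator (tail_part T \<Omega>) x *\<^sub>R zeta_at_inf_integrand s x)"
  using c by (simp add: indicator_def scaleR_in_tail_part_dilation_iff zeta_at_inf_integrand_scaleR)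

lemma borel_measurable_dilated_integrand:
  "(\<lambda>x. indicator (tail_part t (dilation c \<Omega>)) x *\<^sub>R zeta_at_inf_integrand s x) \<in> borel_measurable lebesgue"
proof -
  note [measurable] = sets_dilation[OF c \<Omega>]
  show ?thesis by measurable
qed

lemma set_integrable_dilation_iff:
  "set_integrable lebesgue (tail_part (c * T) (dilation c \<Omega>)) (zeta_at_inf_integrand s) \<longleftrightarrow>
   set_integrable lebesgue (tail_part T \<Omega>) (zeta_at_inf_integrand s)"
proof -
  let ?k = "complex_of_real c powr (- s - of_nat CARD('n))"
  let ?F = "\<lambda>x. indicator (tail_part T \<Omega>) x *\<^sub>R zeta_at_inf_integrand s x"
  have "integrable lebesgue (\<lambda>x. ?k * ?F x) \<longleftrightarrow> integrable lebesgue ?F"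
    using c integrable_mult_right[of ?k lebesgue ?F]
      integrable_mult_right[of "inverse ?k" lebesgue "\<lambda>x. ?k * ?F x"]
    by (auto simp flip: mult.assoc simp del: mult_scaleR_right)
  then show ?thesis
    unfolding set_integrable_def
    by (subst lebesgue_integrable_scaleR_iff[OF c borel_measurable_dilated_integrand])
       (simp only: dilated_integrand_scaleR)
qed

text \<open>The Jacobian \<open>c ^ N\<close> cancels the \<open>N\<close> in the exponent \<open>- s - N\<close>. The two
  integrals converge for the same \<open>s\<close>, and for all other \<open>s\<close> both have the default value
  \<open>0\<close>.\<close>

lemma zeta_at_inf_dilation:
  "zeta_at_inf (dilation c \<Omega>) (c * T) s = of_real c powr (- s) * zeta_at_inf \<Omega> T s"
proof -
  have "zeta_at_inf (dilation c \<Omega>) (c * T) s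
      = c ^ CARD('n) *\<^sub>R (of_real c powr (- s - of_nat CARD('n)) * zeta_at_inf \<Omega> T s)"
    unfolding zeta_at_inf_def set_lebesgue_integral_def
    by (subst lebesgue_integral_scaleR[OF c borel_measurable_dilated_integrand])
       (simp add: dilated_integrand_scaleR del: mult_scaleR_right)
  also have "\<dots> = (of_real c powr of_nat CARD('n) * of_real c powr (- s - of_nat CARD('n))) * zeta_at_inf \<Omega> T s"
    using c by (simp add: scaleR_conv_of_real powr_nat')
  also have "of_real c powr of_nat CARD('n) * of_real c powr (- s - of_nat CARD('n)) = complex_of_real c powr (- s)"
    by (simp flip: powr_add)
  finally show ?thesis .
qed

lemma zeta_at_inf_abscissa_dilation:
  "zeta_at_inf_abscissa (dilation c \<Omega>) (c * T) = zeta_at_inf_abscissa \<Omega> T"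
  by (simp add: zeta_at_inf_abscissa_def set_integrable_dilation_iff)

end

text \<open>Invariance of the dimension is read off from the abscissa, for which it is immediate from
  the change of variables.\<close>

lemma upper_Minkowski_dim_at_inf_dilation:
  fixes \<Omega> :: "(real ^ 'n) set"
  assumes "\<Omega> \<in> sets lebesgue" "emeasure lebesgue \<Omega> < \<infinity>" "0 < c"
  shows "upper_Minkowski_dim_at_inf (dilation c \<Omega>) = upper_Minkowski_dim_at_inf \<Omega>"
proof -
  have "zeta_at_inf_abscissa (dilation c \<Omega>) c = upper_Minkowski_dim_at_inf (dilation c \<Omega>)"
    using assms by (intro zeta_at_inf_abscissa_eq_dim sets_dilation emeasure_dilation_finite)
  moreover have "zeta_at_inf_abscissa \<Omega> 1 = upper_Minkowski_dim_at_inf \<Omega>"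
    using assms by (intro zeta_at_inf_abscissa_eq_dim) auto
  ultimately show ?thesis
    using zeta_at_inf_abscissa_dilation[OF assms(1,3), of 1] by simp
qed

section \<open>Residues of meromorphic extensions\<close>

lemma meromorphic_identity_from_open_subset:
  assumes "f meromorphic_on U" "g meromorphic_on U" "open U" "connected U" "z \<in> U"
    and V: "open V" "V \<noteq> {}" "V \<subseteq> U" "\<And>s. s \<in> V \<Longrightarrow> f s = g s"
  shows "eventually (\<lambda>s. f s = g s) (at z)"
proof -
  let ?d = "\<lambda>s. f s - g s"
  obtain v where v: "v \<in> V" using V by blast
  have "eventually (\<lambda>s. ?d s = 0) (cosparse U) \<or> eventually (\<lambda>s. ?d s \<noteq> 0) (cosparse U)"
    using assms by (intro meromorphic_imp_constant_or_avoid meromorphic_intros) auto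
  moreover have "\<not> eventually (\<lambda>s. ?d s \<noteq> 0) (cosparse U)"
  proof
    assume "eventually (\<lambda>s. ?d s \<noteq> 0) (cosparse U)"
    then have "eventually (\<lambda>s. ?d s \<noteq> 0) (at v)"
      using v V assms by (auto simp: eventually_cosparse_open_eq)
    moreover have "eventually (\<lambda>s. s \<in> V) (at v)"
      using V v by (intro eventually_at_in_open') auto
    ultimately have "eventually (\<lambda>s. False) (at v)"
      by eventually_elim (use V in auto)
    then show False by simp
  qed
  ultimately have "eventually (\<lambda>s. ?d s = 0) (at z)"
    using assms by (auto simp: eventually_cosparse_open_eq)
  then show ?thesis by simp
qed

text \<open>For a simple pole the residue is the limit of \<open>(s - z) * f s\<close>, which the entire factor
  multiplies by its value at \<open>z\<close> and the entire summand does not affect. For a pole of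
  higher order, derivatives of the factor would enter.\<close>

lemma residue_times_plus_analytic:
  assumes mero: "f meromorphic_on {z}" and pole: "is_simple_pole f z"
    and E: "E holomorphic_on UNIV" and h: "h holomorphic_on UNIV"
  shows "residue (\<lambda>s. E s * f s + h s) z = E z * residue f z"
proof -
  have iso: "isolated_singularity_at f z"
    using mero by (rule meromorphic_on_isolated_singularity)
  have pole': "is_pole f z" "zorder f z = -1"
    using pole by (auto simp: is_simple_pole_def)
  obtain e where e: "0 < e" "f holomorphic_on ball z e - {z}"
    using iso analytic_imp_holomorphic unfolding isolated_singularity_at_def by blast
  obtain r where r: "0 < r" "zor_poly f z holomorphic_on cball z r"
    using zorder_exist_pole[OF e(2) _ _ pole'(1)] e(1) by auto
  have "isCont (zor_poly f z) z"
    using r by (intro holomorphic_on_imp_continuous_on[THEN continuous_on_interior]) auto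
  then have "(zor_poly f z \<longlongrightarrow> residue f z) (at z)"
    using residue_simple_pole[OF iso pole'] by (simp add: isCont_def)
  then have lim: "((\<lambda>s. f s * (s - z)) \<longlongrightarrow> residue f z) (at z)"
    by (rule Lim_transform_eventually) (use zor_poly_pole_eq[OF iso pole'(1)] pole'(2) in simp)
  have cont: "E \<midarrow>z\<rightarrow> E z" "h \<midarrow>z\<rightarrow> h z"
    using holomorphic_on_imp_continuous_on[OF E] holomorphic_on_imp_continuous_on[OF h]
    by (auto simp: continuous_on_eq_continuous_at isCont_def)
  have "((\<lambda>s. E s * (f s * (s - z)) + h s * (s - z)) \<longlongrightarrow> E z * residue f z + h z * (z - z)) (at z)"
    by (intro tendsto_intros cont lim)
  then have "((\<lambda>s. (E s * f s + h s) * (s - z)) \<longlongrightarrow> E z * residue f z) (at z)"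
    by (simp add: algebra_simps)
  moreover have "(\<lambda>s. E s * f s + h s) holomorphic_on ball z e - {z}"
    using e E h by (auto intro!: holomorphic_intros intro: holomorphic_on_subset)
  ultimately show ?thesis
    using e by (intro residue_simple'[of "ball z e"]) auto
qed

context
  fixes \<Omega> :: "(real ^ 'n) set" and c T1 T2 :: real and U f
  assumes \<Omega>: "\<Omega> \<in> sets lebesgue" and fin: "emeasure lebesgue \<Omega> < \<infinity>"
    and c: "0 < c" and T: "0 < T1" "0 < T2"
    and f: "zeta_at_inf_mero_extension \<Omega> T1 U f"
begin

text \<open>The scaling relation transports \<open>f\<close> to an extension of the zeta function of the dilated set
  with cutoff \<open>c * T1\<close>; the entire function \<open>h\<close> moves the cutoff to \<open>T2\<close>.\<close>

lemma dilated_mero_extension: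
  obtains h where "h holomorphic_on UNIV"
    "zeta_at_inf_mero_extension (dilation c \<Omega>) T2 U (\<lambda>s. of_real c powr (- s) * f s + h s)"
proof -
  have fin': "emeasure lebesgue (dilation c \<Omega>) < \<infinity>"
    by (rule emeasure_dilation_finite[OF c fin])
  note dim = upper_Minkowski_dim_at_inf_dilation[OF \<Omega> fin c]
  obtain h where h: "h holomorphic_on UNIV"
    "\<And>s. upper_Minkowski_dim_at_inf (dilation c \<Omega>) < ereal (Re s) \<Longrightarrow>
       zeta_at_inf (dilation c \<Omega>) T2 s = zeta_at_inf (dilation c \<Omega>) (c * T1) s + h s"
    using entire_cutoff_difference[OF sets_dilation[OF c \<Omega>] fin' T(2), of "c * T1"] c T by auto
  have "(\<lambda>s. complex_of_real c powr (- s)) analytic_on U" "h analytic_on U"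
    using c h(1) by (auto intro!: analytic_intros intro: analytic_on_subset simp flip: analytic_on_open)
  then have "(\<lambda>s. of_real c powr (- s) * f s + h s) meromorphic_on U"
    using f unfolding zeta_at_inf_mero_extension_def
    by (intro meromorphic_on_add meromorphic_on_mult) (auto intro: analytic_on_imp_meromorphic_on)
  then have "zeta_at_inf_mero_extension (dilation c \<Omega>) T2 U (\<lambda>s. of_real c powr (- s) * f s + h s)"
    using f h(2) unfolding zeta_at_inf_mero_extension_def dim
    by (auto simp: zeta_at_inf_dilation[OF \<Omega> c])
  with h(1) show ?thesis by (rule that)
qed

end

text \<open>Both functions agree with the zeta function on the part of \<open>U\<close> to the right of the critical
  line. This part is open, and it is nonempty because \<open>U\<close> is a neighbourhood of that line; if the
  dimension is \<open>- \<infinity>\<close>, it is all of \<open>U\<close>. The identity theorem on the connected set \<open>U\<close> does the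
  rest. Meromorphic functions may take arbitrary values at isolated points, whence equality
  only on a punctured neighbourhood.\<close>

lemma mero_extension_unique:
  fixes \<Omega> :: "(real ^ 'n) set"
  assumes \<Omega>: "\<Omega> \<in> sets lebesgue" "emeasure lebesgue \<Omega> < \<infinity>"
    and g: "zeta_at_inf_mero_extension \<Omega> T U g1" "zeta_at_inf_mero_extension \<Omega> T U g2"
    and z: "z \<in> U"
  shows "eventually (\<lambda>s. g1 s = g2 s) (at z)"
proof -
  let ?d = "upper_Minkowski_dim_at_inf \<Omega>"
  define V where "V = {s \<in> U. ?d < ereal (Re s)}"
  have U: "open U" "connected U" "{s. ereal (Re s) = ?d} \<subseteq> U"
    "g1 meromorphic_on U" "g2 meromorphic_on U"
    using g by (auto simp: zeta_at_inf_mero_extension_def)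
  have "open V \<and> V \<noteq> {}"
  proof (cases ?d)
    case (real d)
    then have V: "V = U \<inter> {s. d < Re s}"
      by (auto simp: V_def)
    have "of_real d \<in> U"
      using U(3) real by auto
    then obtain e where e: "0 < e" "ball (of_real d) e \<subseteq> U"
      using U(1) open_contains_ball by blast
    have "complex_of_real (d + e / 2) \<in> ball (of_real d) e"
      using e(1) by (simp add: dist_norm flip: of_real_diff)
    then have "complex_of_real (d + e / 2) \<in> V"
      using e unfolding V by auto
    then show ?thesis
      using U(1) unfolding V by (auto intro: open_Int open_halfspace_Re_gt)
  next
    case PInf
    moreover have "?d \<le> ereal 0"
      unfolding upper_Minkowski_dim_at_inf_def
      using content_zero_above_minus_dimension[OF \<Omega>, of 0] by (intro Inf_lower) auto
    ultimately show ?thesis by simp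
  next
    case MInf
    then have "V = U" by (auto simp: V_def)
    then show ?thesis using U(1) z by auto
  qed
  moreover have "g1 s = g2 s" if "s \<in> V" for s
    using that g by (auto simp: V_def zeta_at_inf_mero_extension_def)
  moreover have "V \<subseteq> U" by (auto simp: V_def)
  ultimately show ?thesis
    using U z by (intro meromorphic_identity_from_open_subset[of _ U _ z V]) auto
qed

lemma residue_dilation:
  fixes \<Omega> :: "(real ^ 'n) set"
  assumes \<Omega>: "\<Omega> \<in> sets lebesgue" and fin: "emeasure lebesgue \<Omega> < \<infinity>"
    and c: "0 < c" and T: "0 < T1" "0 < T2"
    and f: "zeta_at_inf_mero_extension \<Omega> T1 U f" and \<omega>: "\<omega> \<in> U" "is_simple_pole f \<omega>"
    and g: "zeta_at_inf_mero_extension (dilation c \<Omega>) T2 U g"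
  shows "residue g \<omega> = of_real c powr (- \<omega>) * residue f \<omega>"
proof -
  obtain h where h: "h holomorphic_on UNIV"
    "zeta_at_inf_mero_extension (dilation c \<Omega>) T2 U (\<lambda>s. of_real c powr (- s) * f s + h s)"
    using dilated_mero_extension[OF \<Omega> fin c T f] by blast
  have fin': "emeasure lebesgue (dilation c \<Omega>) < \<infinity>"
    by (rule emeasure_dilation_finite[OF c fin])
  have "residue g \<omega> = residue (\<lambda>s. of_real c powr (- s) * f s + h s) \<omega>"
    by (rule residue_cong[OF mero_extension_unique[OF sets_dilation[OF c \<Omega>] fin' g h(2) \<omega>(1)] refl])
  also have "\<dots> = of_real c powr (- \<omega>) * residue f \<omega>"
  proof (rule residue_times_plus_analytic[OF _ \<omega>(2) _ h(1)])
    show "f meromorphic_on {\<omega>}"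
      using f \<omega>(1) unfolding zeta_at_inf_mero_extension_def by (blast intro: meromorphic_on_subset)
    show "(\<lambda>s. complex_of_real c powr (- s)) holomorphic_on UNIV"
      using c by (auto intro!: holomorphic_intros)
  qed
  finally show ?thesis .
qed

theorem proposition4p2:
  fixes \<Omega> :: "(real ^ 'n) set" and T c :: real
  assumes "\<Omega> \<in> sets lebesgue" and "emeasure lebesgue \<Omega> < \<infinity>"
    and "T > 0" and "c > 0"
  shows "(\<forall>T1>0. \<forall>T2>0.
            zeta_at_inf_abscissa (dilation c \<Omega>) T1 = zeta_at_inf_abscissa \<Omega> T2 \<and>
            zeta_at_inf_abscissa \<Omega> T2 = upper_Minkowski_dim_at_inf \<Omega>)
       \<and> (\<forall>s. ereal (Re s) > upper_Minkowski_dim_at_inf \<Omega> \<longrightarrow>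
            zeta_at_inf (dilation c \<Omega>) (c * T) s = complex_of_real c powr (- s) * zeta_at_inf \<Omega> T s)
       \<and> (\<forall>T1>0. \<forall>T2>0. \<forall>U f \<omega>.
            zeta_at_inf_mero_extension \<Omega> T1 U f \<and> \<omega> \<in> U \<and> is_simple_pole f \<omega> \<longrightarrow>
            (\<exists>g. zeta_at_inf_mero_extension (dilation c \<Omega>) T2 U g) \<and>
            (\<forall>g. zeta_at_inf_mero_extension (dilation c \<Omega>) T2 U g \<longrightarrow>
               residue g \<omega> = complex_of_real c powr (- \<omega>) * residue f \<omega>))"
proof (intro conjI allI impI; (elim conjE)?)
  fix T1 T2 :: real
  assume T12: "T1 > 0" "T2 > 0"
  show dim: "zeta_at_inf_abscissa \<Omega> T2 = upper_Minkowski_dim_at_inf \<Omega>"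
    using assms T12 by (intro zeta_at_inf_abscissa_eq_dim)
  have "zeta_at_inf_abscissa (dilation c \<Omega>) T1 = upper_Minkowski_dim_at_inf (dilation c \<Omega>)"
    using assms T12 by (intro zeta_at_inf_abscissa_eq_dim sets_dilation emeasure_dilation_finite)
  then show "zeta_at_inf_abscissa (dilation c \<Omega>) T1 = zeta_at_inf_abscissa \<Omega> T2"
    using upper_Minkowski_dim_at_inf_dilation[OF assms(1,2,4)] dim by simp
next
  fix s
  show "zeta_at_inf (dilation c \<Omega>) (c * T) s = complex_of_real c powr (- s) * zeta_at_inf \<Omega> T s"
    by (rule zeta_at_inf_dilation[OF assms(1,4)])
next
  fix T1 T2 :: real and U f \<omega>
  assume *: "T1 > 0" "T2 > 0" "zeta_at_inf_mero_extension \<Omega> T1 U f"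
  show "\<exists>g. zeta_at_inf_mero_extension (dilation c \<Omega>) T2 U g"
    using dilated_mero_extension[OF assms(1,2,4) *] by blast
  fix g
  assume "\<omega> \<in> U" "is_simple_pole f \<omega>" "zeta_at_inf_mero_extension (dilation c \<Omega>) T2 U g"
  then show "residue g \<omega> = complex_of_real c powr (- \<omega>) * residue f \<omega>"
    by (rule residue_dilation[OF assms(1,2,4) *])
qed

end
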